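(* Let $n\ge2$ and $S=(s_1,\ldots,s_n)\in\mathcal{G}_n$. If $k\in K_S$, then $$|k-s_n|\le A(S)+1.$$
   Context: For a finite integer sequence $S=(s_1,\ldots,s_n)$, its difference triangle is defined by $s_a^0:=s_a$ and $s_a^b:=|s_{a+1}^{b-1}-s_a^{b-1}|$ for $b\ge 1$, $1\le a\le n-b$ (superscripts are row indices, not powers). $S$ is Gilbreath if $s_1^b=1$ for every $1\le b\le n-1$. For $n\ge 2$, $\mathcal{G}_n$ is the set of strictly increasing Gilbreath integer sequences $(s_1,\ldots,s_n)$ of length $n$ with $(s_1,s_2)=(2,3)$. The valid-extension set of $S$ is $K_S:=\{k\in\mathbb{Z}:(s_1,\ldots,s_n,k)\text{ is Gilbreath}\}$. The right anti-diagonal of $S$ is $(e_1,\ldots,e_{n-1})$ with $e_i:=s_{n-i}^i$, and $A(S):=\sum_{i=1}^{n-1}e_i$. *)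

theory Defs
  imports Main
begin

text \<open>
  A sequence \<open>(s\<^sub>1, \<dots>, s\<^sub>n)\<close> is an \<open>int list\<close> of length \<open>n\<close>; the column index \<open>a\<close> of its
  difference triangle starts at 1, so \<open>s\<^sub>a\<close> is \<open>S ! (a - 1)\<close>.
  \<open>diff_tri S b a\<close> is the entry of row \<open>b\<close> and column \<open>a\<close>. It is meaningful for
  \<open>1 \<le> a\<close> and \<open>a + b \<le> length S\<close>, the only entries that are used below.
\<close>
primrec diff_tri :: "int list \<Rightarrow> nat \<Rightarrow> nat \<Rightarrow> int" where
  "diff_tri S 0 a = S ! (a - 1)"
| "diff_tri S (Suc b) a = \<bar>diff_tri S b (a + 1) - diff_tri S b a\<bar>"

definition gilbreath :: "int list \<Rightarrow> bool" where
  "gilbreath S \<longleftrightarrow> (\<forall>b. 1 \<le> b \<and> b \<le> length S - 1 \<longrightarrow> diff_tri S b 1 = 1)"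

text \<open>Only intended for \<open>n \<ge> 2\<close>.\<close>
definition gilbreath_seqs :: "nat \<Rightarrow> int list set" where
  "gilbreath_seqs n =
    {S. length S = n \<and> sorted_wrt (<) S \<and> gilbreath S \<and> S ! 0 = 2 \<and> S ! 1 = 3}"

definition valid_ext :: "int list \<Rightarrow> int set" where
  "valid_ext S = {k. gilbreath (S @ [k])}"

definition antidiag :: "int list \<Rightarrow> nat \<Rightarrow> int" where
  "antidiag S i = diff_tri S i (length S - i)"

definition antidiag_sum :: "int list \<Rightarrow> int" where
  "antidiag_sum S = (\<Sum>i = 1..length S - 1. antidiag S i)"

end

theory Submission
  imports Defs
begin

text \<open>
  Let \<open>f\<^sub>i\<close> be the right anti-diagonal of \<open>S @ [k]\<close> and \<open>e\<^sub>i\<close> that of \<open>S\<close>. Then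
  \<open>f\<^sub>i\<^sub>+\<^sub>1 = \<bar>f\<^sub>i - e\<^sub>i\<bar>\<close>, hence \<open>f\<^sub>i \<le> e\<^sub>i + f\<^sub>i\<^sub>+\<^sub>1\<close>. Telescoping from \<open>f\<^sub>1 = \<bar>k - s\<^sub>n\<bar>\<close>
  to \<open>f\<^sub>n = 1\<close> gives the bound.
\<close>

text \<open>Row \<open>b\<close>, column \<open>a\<close> depends only on the terms at positions
  \<open>a\<close> to \<open>a + b\<close>, all inside \<open>S\<close>.\<close>

lemma diff_tri_append:
  assumes "1 \<le> a" and "a + b \<le> length S"
  shows "diff_tri (S @ T) b a = diff_tri S b a"
  using assms by (induction b arbitrary: a) (auto simp: nth_append)

text \<open>The new entry lies in column \<open>length S - i\<close>; its right parent is on the new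
  anti-diagonal, its left parent on that of \<open>S\<close>.\<close>

lemma antidiag_snoc_Suc:
  assumes "i < length S"
  shows "antidiag (S @ [k]) (Suc i) = \<bar>antidiag (S @ [k]) i - antidiag S i\<bar>"
  using assms by (simp add: antidiag_def diff_tri_append Suc_diff_le)

lemma antidiag_snoc_le:
  assumes "m < length S"
  shows "antidiag (S @ [k]) 1 \<le> (\<Sum>i = 1..m. antidiag S i) + antidiag (S @ [k]) (Suc m)"
  using assms
proof (induction m)
  case 0
  then show ?case by simp
next
  case (Suc m)
  then show ?case using antidiag_snoc_Suc[of "Suc m" S k] by simp
qed

theorem corollary3:
  fixes n :: nat and S :: "int list" and k :: int
  assumes "n \<ge> 2"
    and "S \<in> gilbreath_seqs n"
    and "k \<in> valid_ext S"
  shows "\<bar>k - S ! (n - 1)\<bar> \<le> antidiag_sum S + 1"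
proof -
  have len: "length S = n"
    using assms(2) by (simp add: gilbreath_seqs_def)
  \<comment> \<open>At \<open>i = 0\<close> the anti-diagonals hold the last terms, \<open>k\<close>
    and \<open>S ! (n - 1)\<close>.\<close>
  have "antidiag (S @ [k]) 1 = \<bar>k - S ! (n - 1)\<bar>"
    using antidiag_snoc_Suc[of 0 S k] assms(1) len by (simp add: antidiag_def nth_append)
  \<comment> \<open>As \<open>S @ [k]\<close> has length \<open>n + 1\<close>, index
    \<open>n\<close> falls in column 1, where the Gilbreath condition applies.\<close>
  moreover have "antidiag (S @ [k]) n = 1"
    using assms(1,3) len by (simp add: antidiag_def valid_ext_def gilbreath_def)
  ultimately show ?thesis
    using antidiag_snoc_le[of "n - 1" S k] assms(1) len by (simp add: antidiag_sum_def)
qed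

end
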